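(* Consider the adversarial convex body chasing game described in the context. Assume moreover: (a) there is a constant $L_c\ge 0$ such that $|c(\mathbf x,\mathbf y)-c(\mathbf x',\mathbf y')|\le L_c(\|\mathbf x-\mathbf x'\|+\|\mathbf y-\mathbf y'\|)$ for all $(\mathbf x,\mathbf y),(\mathbf x',\mathbf y')\in\mathcal X\times\mathcal X$; (b) there is a constant $L_\Theta\ge 0$ such that for all $t\in\{1,\dots,T\}$, all $i\in\mathcal V$, all $j\in\mathcal V$ with $i\in\mathcal N_j$, and all $\mathbf x,\mathbf x'\in\mathcal Q_{t-1}^{(j)}$, $\mathrm{dist}_{\mathrm H}(\Theta_t^{(i)}(\mathbf x),\Theta_t^{(i)}(\mathbf x'))\le L_\Theta\|\mathbf x-\mathbf x'\|$. For $t\in\{1,\dots,T\}$ put $$L_{v,t}=L_c\sum_{k=1}^{T-t+1}(1+L_\Theta)^k .$$ Then for all $t\in\{1,\dots,T\}$, $i_{t-1}\in\mathcal V$ and $i_t\in\mathcal N_{i_{t-1}}$, the functions $V_t(\cdot,i_t)$ and $U_t(\cdot,i_{t-1})$ are both $L_{v,t}$-Lipschitz continuous on $\mathcal Q_{t-1}^{(i_{t-1})}$: for all $\mathbf x,\mathbf x'\in\mathcal Q_{t-1}^{(i_{t-1})}$, $$|V_t(\mathbf x,i_t)-V_t(\mathbf x',i_t)|\le L_{v,t}\|\mathbf x-\mathbf x'\|\quad\text{and}\quad |U_t(\mathbf x,i_{t-1})-U_t(\mathbf x',i_{t-1})|\le L_{v,t}\|\mathbf x-\mathbf x'\|.$$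
   Context: Setting. $\mathcal X$ is a compact subset of $\mathbb R^d$ equipped with a norm $\|\cdot\|$; $T\ge 1$ is an integer horizon. A set is solid if it has nonempty interior. A correspondence (set-valued map) $F:A\rightsquigarrow B$ assigns to each point of $A$ a subset of $B$. It is upper semi-continuous at $\mathbf x\in A$ if for every open $O\subseteq B$ with $F(\mathbf x)\subseteq O$ there is a neighborhood $N$ of $\mathbf x$ with $F(\mathbf x')\subseteq O$ for all $\mathbf x'\in N$; lower semi-continuous at $\mathbf x$ if for every open $O\subseteq B$ with $F(\mathbf x)\cap O\ne\emptyset$ there is a neighborhood $N$ of $\mathbf x$ with $F(\mathbf x')\cap O\neq\emptyset$ for all $\mathbf x'\in N$; continuous if it is both at every point. The Hausdorff distance of two sets is $\mathrm{dist}_{\mathrm H}(E,F)=\max\{\sup_{\mathbf x\in E}\inf_{\mathbf y\in F}\|\mathbf x-\mathbf y\|,\ \sup_{\mathbf y\in F}\inf_{\mathbf x\in E}\|\mathbf x-\mathbf y\|\}$. Data. $\mathcal G=(\mathcal V,\mathcal E)$ is a finite directed graph, $\mathcal N_i=\{j\in\mathcal V:(i,j)\in\mathcal E\}$, assumed nonempty for each $i\in\mathcal V$. $\mathcal Q=\{\mathcal Q_t^{(i)}\}_{t=0,\dots,T;\,i\in\mathcal V}$ is a collection of subsets of $\mathcal X$. $\mathcal R:\mathcal X\rightsquigarrow\mathcal X$ is the reachability correspondence, and $c:\mathcal X\times\mathcal X\to\mathbb R$ is a nonnegative cost function. Assumptions. (1) $\mathcal R(\mathbf x)$ is solid, compact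 and convex for all $\mathbf x\in\mathcal X$. (2) Each $\mathcal Q_t^{(i)}$ is solid, compact and convex. (3) For all $t\in\{1,\dots,T\}$, $i\in\mathcal V$, $j\in\mathcal N_i$ and $\mathbf x\in\mathcal Q_{t-1}^{(i)}$: $\mathrm{int}(\mathcal R(\mathbf x)\cap\mathcal Q_t^{(j)})\neq\emptyset$. (4) $c$ is continuous. (5) $\mathcal R$ is continuous. Interiors are taken in $\mathbb R^d$. Write $\Theta_t^{(j)}(\mathbf x)=\mathcal R(\mathbf x)\cap\mathcal Q_t^{(j)}$. Value functions. For $t\in\{1,\dots,T\}$, $V_t(\mathbf x,j)$ is defined for $\mathbf x\in\mathcal Q_{t-1}^{(i)}$ and $j\in\mathcal N_i$ (for some $i\in\mathcal V$), and $U_t(\mathbf x,i)$ for $i\in\mathcal V$, $\mathbf x\in\mathcal Q_{t-1}^{(i)}$, by backward recursion (the infima are attained under these assumptions, so $\inf$ may be read as $\min$): $$V_T(\mathbf x,j)=\inf_{\mathbf y\in\Theta_T^{(j)}(\mathbf x)}c(\mathbf x,\mathbf y),\qquad V_t(\mathbf x,j)=\inf_{\mathbf y\in\Theta_t^{(j)}(\mathbf x)}\Big\{c(\mathbf x,\mathbf y)+\max_{k\in\mathcal N_j}V_{t+1}(\mathbf y,k)\Big\}\ (1\le t\le T-1),$$ $$U_T(\mathbf x,i)=\max_{j\in\mathcal N_i}\ \inf_{\mathbf y\in\Theta_T^{(j)}(\mathbf x)}c(\mathbf x,\mathbf y),\qquad U_t(\mathbf x,i)=\max_{j\in\mathcal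 N_i}\ \inf_{\mathbf y\in\Theta_t^{(j)}(\mathbf x)}\{c(\mathbf x,\mathbf y)+U_{t+1}(\mathbf y,j)\}\ (1\le t\le T-1).$$ *)

theory Defs
  imports "HOL-Analysis.Analysis"
begin

text \<open>
  The norm on the space is an arbitrary one, passed as a function. All norms on \<open>real ^ 'd\<close> induce
  the same topology, so the topological notions (\<open>compact\<close>, \<open>interior\<close>, \<open>continuous_on\<close>, ...) are
  the library's; every distance is measured with the given norm.
\<close>

definition is_norm :: "('a::real_vector \<Rightarrow> real) \<Rightarrow> bool" where
  "is_norm \<nu> \<longleftrightarrow>
     (\<forall>x. 0 \<le> \<nu> x) \<and>
     (\<forall>x. \<nu> x = 0 \<longleftrightarrow> x = 0) \<and>
     (\<forall>a x. \<nu> (a *\<^sub>R x) = \<bar>a\<bar> * \<nu> x) \<and>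
     (\<forall>x y. \<nu> (x + y) \<le> \<nu> x + \<nu> y)"

text \<open>
  Real-valued, hence meaningful only for nonempty bounded sets; below it is applied
  to nonempty compact sets only.
\<close>

definition hausdorff_dist :: "('a::real_vector \<Rightarrow> real) \<Rightarrow> 'a set \<Rightarrow> 'a set \<Rightarrow> real" where
  "hausdorff_dist \<nu> E F =
     max (SUP x\<in>E. INF y\<in>F. \<nu> (x - y)) (SUP y\<in>F. INF x\<in>E. \<nu> (x - y))"

definition correspondence :: "'a set \<Rightarrow> 'b set \<Rightarrow> ('a \<Rightarrow> 'b set) \<Rightarrow> bool" where
  "correspondence A B F \<longleftrightarrow> (\<forall>x\<in>A. F x \<subseteq> B)"

definition upper_semicontinuous_at ::
    "'a::topological_space set \<Rightarrow> 'b::topological_space set \<Rightarrow> ('a \<Rightarrow> 'b set) \<Rightarrow> 'a \<Rightarrow> bool" where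
  "upper_semicontinuous_at A B F x \<longleftrightarrow>
     (\<forall>S. openin (top_of_set B) S \<and> F x \<subseteq> S \<longrightarrow>
        (\<exists>N. openin (top_of_set A) N \<and> x \<in> N \<and> (\<forall>x'\<in>N. F x' \<subseteq> S)))"

definition lower_semicontinuous_at ::
    "'a::topological_space set \<Rightarrow> 'b::topological_space set \<Rightarrow> ('a \<Rightarrow> 'b set) \<Rightarrow> 'a \<Rightarrow> bool" where
  "lower_semicontinuous_at A B F x \<longleftrightarrow>
     (\<forall>S. openin (top_of_set B) S \<and> F x \<inter> S \<noteq> {} \<longrightarrow>
        (\<exists>N. openin (top_of_set A) N \<and> x \<in> N \<and> (\<forall>x'\<in>N. F x' \<inter> S \<noteq> {})))"

definition continuous_correspondence ::
    "'a::topological_space set \<Rightarrow> 'b::topological_space set \<Rightarrow> ('a \<Rightarrow> 'b set) \<Rightarrow> bool" where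
  "continuous_correspondence A B F \<longleftrightarrow>
     (\<forall>x\<in>A. upper_semicontinuous_at A B F x \<and> lower_semicontinuous_at A B F x)"

definition solid :: "'a::topological_space set \<Rightarrow> bool" where
  "solid S \<longleftrightarrow> interior S \<noteq> {}"

definition nbrs :: "'v set \<Rightarrow> ('v \<times> 'v) set \<Rightarrow> 'v \<Rightarrow> 'v set" where
  "nbrs \<V> \<E> i = {j \<in> \<V>. (i, j) \<in> \<E>}"

definition Theta :: "('a \<Rightarrow> 'a set) \<Rightarrow> (nat \<Rightarrow> 'v \<Rightarrow> 'a set) \<Rightarrow> nat \<Rightarrow> 'v \<Rightarrow> 'a \<Rightarrow> 'a set" where
  "Theta \<R> Q t j x = \<R> x \<inter> Q t j"

text \<open>
  The value functions of the game with cost \<open>c\<close>, feasible sets \<open>\<Theta>\<close>, neighbourhoods \<open>\<N>\<close> and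
  horizon \<open>T\<close>. The test \<open>T \<le> t\<close> (rather than \<open>t = T\<close>) only makes the recursion terminate;
  the values for \<open>t > T\<close> carry no meaning.
\<close>

function V_value ::
    "('a \<Rightarrow> 'a \<Rightarrow> real) \<Rightarrow> (nat \<Rightarrow> 'v \<Rightarrow> 'a \<Rightarrow> 'a set) \<Rightarrow> ('v \<Rightarrow> 'v set) \<Rightarrow> nat \<Rightarrow> nat \<Rightarrow> 'a \<Rightarrow> 'v \<Rightarrow> real"
  where
  "V_value c \<Theta> \<N> T t x j =
     (if T \<le> t then (INF y\<in>\<Theta> t j x. c x y)
      else (INF y\<in>\<Theta> t j x. c x y + (MAX k\<in>\<N> j. V_value c \<Theta> \<N> T (t + 1) y k)))"
  by pat_completeness auto
termination by (relation "Wellfounded.measure (\<lambda>(c, \<Theta>, \<N>, T, t, x, j). T - t)") auto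

function U_value ::
    "('a \<Rightarrow> 'a \<Rightarrow> real) \<Rightarrow> (nat \<Rightarrow> 'v \<Rightarrow> 'a \<Rightarrow> 'a set) \<Rightarrow> ('v \<Rightarrow> 'v set) \<Rightarrow> nat \<Rightarrow> nat \<Rightarrow> 'a \<Rightarrow> 'v \<Rightarrow> real"
  where
  "U_value c \<Theta> \<N> T t x i =
     (if T \<le> t then (MAX j\<in>\<N> i. INF y\<in>\<Theta> t j x. c x y)
      else (MAX j\<in>\<N> i. INF y\<in>\<Theta> t j x. c x y + U_value c \<Theta> \<N> T (t + 1) y j))"
  by pat_completeness auto
termination by (relation "Wellfounded.measure (\<lambda>(c, \<Theta>, \<N>, T, t, x, i). T - t)") auto

declare V_value.simps [simp del] U_value.simps [simp del]

lemma V_value_final: "V_value c \<Theta> \<N> T T x j = (INF y\<in>\<Theta> T j x. c x y)"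
  by (subst V_value.simps) simp

lemma V_value_step:
  "t < T \<Longrightarrow> V_value c \<Theta> \<N> T t x j =
     (INF y\<in>\<Theta> t j x. c x y + (MAX k\<in>\<N> j. V_value c \<Theta> \<N> T (t + 1) y k))"
  by (subst V_value.simps) simp

lemma U_value_final: "U_value c \<Theta> \<N> T T x i = (MAX j\<in>\<N> i. INF y\<in>\<Theta> T j x. c x y)"
  by (subst U_value.simps) simp

lemma U_value_step:
  "t < T \<Longrightarrow> U_value c \<Theta> \<N> T t x i =
     (MAX j\<in>\<N> i. INF y\<in>\<Theta> t j x. c x y + U_value c \<Theta> \<N> T (t + 1) y j)"
  by (subst U_value.simps) simp

definition lip_const :: "real \<Rightarrow> real \<Rightarrow> nat \<Rightarrow> nat \<Rightarrow> real" where
  "lip_const L\<^sub>c L\<^sub>\<Theta> T t = L\<^sub>c * (\<Sum>k = 1..T - t + 1. (1 + L\<^sub>\<Theta>) ^ k)"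

end

theory Submission
  imports Defs
begin

text \<open>
  By backward induction on \<open>t\<close>. A point of \<open>\<Theta> x\<close> can be replaced by one of \<open>\<Theta> x'\<close> at distance
  at most \<open>L\<^sub>\<Theta> * \<nu> (x - x')\<close>, up to an arbitrarily small error, so minimising a cost plus an
  \<open>L\<close>-Lipschitz continuation value gives a function of \<open>x\<close> with Lipschitz constant
  \<open>L\<^sub>c * (1 + L\<^sub>\<Theta>) + L * L\<^sub>\<Theta>\<close>; the maximum over the finitely many neighbours preserves it.
\<close>

section \<open>Boundedness in an arbitrary norm\<close>

lemma is_norm_minus_commute:
  assumes "is_norm \<nu>"
  shows "\<nu> (x - y) = \<nu> (y - x)"
proof -
  have "\<nu> ((-1) *\<^sub>R (y - x)) = \<bar>-1\<bar> * \<nu> (y - x)"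
    using assms unfolding is_norm_def by blast
  then show ?thesis by simp
qed

lemma is_norm_sum_le:
  assumes "is_norm \<nu>" "finite A"
  shows "\<nu> (\<Sum>b\<in>A. f b) \<le> (\<Sum>b\<in>A. \<nu> (f b))"
  using assms(2)
proof induction
  case empty
  have "\<nu> 0 = 0" using assms(1) unfolding is_norm_def by blast
  then show ?case by simp
next
  case (insert b A)
  have "\<nu> (f b + sum f A) \<le> \<nu> (f b) + \<nu> (sum f A)"
    using assms(1) by (simp add: is_norm_def)
  with insert show ?case by simp
qed

text \<open>Basis expansion, the triangle inequality and \<open>norm x\<close> as a bound on every
  coordinate give this half of norm equivalence. It carries the library's Euclidean
  \<open>bounded\<close> over to \<nu>.\<close>

lemma is_norm_le_norm:
  fixes \<nu> :: "'a::euclidean_space \<Rightarrow> real"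
  assumes "is_norm \<nu>"
  shows "\<nu> x \<le> (\<Sum>b\<in>Basis. \<nu> b) * norm x"
proof -
  have "\<nu> x = \<nu> (\<Sum>b\<in>Basis. (x \<bullet> b) *\<^sub>R b)"
    by (simp add: euclidean_representation)
  also have "\<dots> \<le> (\<Sum>b\<in>Basis. \<nu> ((x \<bullet> b) *\<^sub>R b))"
    by (rule is_norm_sum_le[OF assms]) simp
  also have "\<dots> = (\<Sum>b\<in>Basis. \<bar>x \<bullet> b\<bar> * \<nu> b)"
    using assms by (simp add: is_norm_def)
  also have "\<dots> \<le> (\<Sum>b\<in>Basis. norm x * \<nu> b)"
    using assms by (intro sum_mono mult_right_mono) (auto simp: Basis_le_norm is_norm_def)
  finally show ?thesis by (simp add: sum_distrib_left mult.commute)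
qed

lemma is_norm_bounded_diff:
  fixes \<nu> :: "'a::euclidean_space \<Rightarrow> real"
  assumes "is_norm \<nu>" "bounded E"
  obtains B where "\<And>x. x \<in> E \<Longrightarrow> \<nu> (x - y) \<le> B"
proof -
  obtain M where M: "\<And>x. x \<in> E \<Longrightarrow> norm x \<le> M"
    using assms(2) by (auto simp: bounded_iff)
  have "\<nu> (x - y) \<le> (\<Sum>b\<in>Basis. \<nu> b) * (M + norm y)" if "x \<in> E" for x
  proof -
    have "norm (x - y) \<le> M + norm y"
      using norm_triangle_ineq4[of x y] M[OF that] by linarith
    moreover have "0 \<le> (\<Sum>b\<in>Basis. \<nu> b)"
      using assms(1) by (simp add: is_norm_def sum_nonneg)
    ultimately show ?thesis
      using is_norm_le_norm[OF assms(1), of "x - y"] by (meson mult_left_mono order_trans)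
  qed
  then show ?thesis using that by blast
qed

section \<open>Hausdorff distance, infima and maxima\<close>

lemma hausdorff_dist_commute:
  assumes "is_norm \<nu>"
  shows "hausdorff_dist \<nu> E F = hausdorff_dist \<nu> F E"
  unfolding hausdorff_dist_def by (simp add: is_norm_minus_commute[OF assms] max.commute)

text \<open>The infimum over \<open>F\<close> is not shown to be attained, so \<open>y\<close> is
  found only up to the slack \<open>e\<close>. Boundedness of \<open>E\<close> makes the outer
  supremum a genuine upper bound.\<close>

lemma hausdorff_dist_approx:
  fixes \<nu> :: "'a::euclidean_space \<Rightarrow> real"
  assumes \<nu>: "is_norm \<nu>" and "bounded E" and "F \<noteq> {}"
    and "hausdorff_dist \<nu> E F \<le> r" and "x \<in> E" and "e > 0"
  obtains y where "y \<in> F" "\<nu> (x - y) < r + e"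
proof -
  obtain z where z: "z \<in> F" using \<open>F \<noteq> {}\<close> by blast
  obtain B where B: "\<And>x. x \<in> E \<Longrightarrow> \<nu> (x - z) \<le> B"
    using is_norm_bounded_diff[OF \<nu> \<open>bounded E\<close>] by blast
  have below: "bdd_below ((\<lambda>y. \<nu> (x - y)) ` F)" for x
    using \<nu> by (intro bdd_belowI2[where m = 0]) (simp add: is_norm_def)
  \<comment> \<open>One fixed point \<open>z\<close> of \<open>F\<close> caps the inner infima for
    all \<open>x\<close> in \<open>E\<close> at once.\<close>
  have "(INF y\<in>F. \<nu> (x - y)) \<le> B" if "x \<in> E" for x
    using cINF_lower[OF below z] B[OF that] by (rule order_trans)
  then have "bdd_above ((\<lambda>x. INF y\<in>F. \<nu> (x - y)) ` E)"
    by (rule bdd_aboveI2)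
  then have "(INF y\<in>F. \<nu> (x - y)) \<le> hausdorff_dist \<nu> E F"
    unfolding hausdorff_dist_def by (intro max.coboundedI1 cSUP_upper[OF \<open>x \<in> E\<close>])
  with assms have "(INF y\<in>F. \<nu> (x - y)) < r + e" by linarith
  then show ?thesis
    using that cINF_less_iff[OF \<open>F \<noteq> {}\<close> below] by blast
qed

text \<open>Two objectives appear because the cost also depends on the current state:
  \<open>a\<close> absorbs the change of state, \<open>K\<close> the move from a point of
  \<open>E\<close> to a nearby point of \<open>F\<close>.\<close>

lemma INF_le_of_hausdorff_dist_le:
  fixes \<nu> :: "'a::euclidean_space \<Rightarrow> real" and f g :: "'a \<Rightarrow> real"
  assumes \<nu>: "is_norm \<nu>" and "bounded E" "bounded F" "E \<noteq> {}" "F \<noteq> {}"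
    and r: "hausdorff_dist \<nu> E F \<le> r" and "K \<ge> 0"
    and fg: "\<And>x y. x \<in> E \<Longrightarrow> y \<in> F \<Longrightarrow> \<bar>f x - g y\<bar> \<le> a + K * \<nu> (x - y)"
  shows "(INF y\<in>F. g y) \<le> (INF x\<in>E. f x) + (a + K * r)"
proof -
  obtain z where z: "z \<in> E" using \<open>E \<noteq> {}\<close> by blast
  obtain B where B: "\<And>y. y \<in> F \<Longrightarrow> \<nu> (y - z) \<le> B"
    using is_norm_bounded_diff[OF \<nu> \<open>bounded F\<close>] by blast
  \<comment> \<open>The real infimum of \<open>g\<close> needs a lower bound; comparing with the
    single value \<open>f z\<close> supplies one.\<close>
  have "f z - (a + K * B) \<le> g y" if "y \<in> F" for y
    using fg[OF z that] mult_left_mono[OF B[OF that] \<open>K \<ge> 0\<close>]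
      is_norm_minus_commute[OF \<nu>, of y z] by simp
  then have below: "bdd_below (g ` F)" by (rule bdd_belowI2)
  have "(INF y\<in>F. g y) - (a + K * r) \<le> f x" if x: "x \<in> E" for x
  proof (rule field_le_epsilon)
    fix e :: real assume "e > 0"
    \<comment> \<open>The divisor \<open>K + 1\<close> is positive even for \<open>K = 0\<close>,
      and \<open>K * (e / (K + 1)) <= e\<close>.\<close>
    then have "e / (K + 1) > 0" using \<open>K \<ge> 0\<close> by simp
    then obtain y where y: "y \<in> F" "\<nu> (x - y) < r + e / (K + 1)"
      using hausdorff_dist_approx[OF \<nu> \<open>bounded E\<close> \<open>F \<noteq> {}\<close> r x] by blast
    have "K * \<nu> (x - y) \<le> K * (r + e / (K + 1))"
      using y \<open>K \<ge> 0\<close> by (intro mult_left_mono) auto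
    also have "\<dots> \<le> K * r + e"
      using \<open>K \<ge> 0\<close> \<open>e > 0\<close> by (simp add: field_simps)
    finally show "(INF y\<in>F. g y) - (a + K * r) \<le> f x + e"
      using fg[OF x y(1)] cINF_lower[OF below y(1)] by simp
  qed
  then have "(INF y\<in>F. g y) - (a + K * r) \<le> (INF x\<in>E. f x)"
    using \<open>E \<noteq> {}\<close> by (intro cINF_greatest)
  then show ?thesis by simp
qed

lemma INF_diff_le_of_hausdorff_dist_le:
  fixes \<nu> :: "'a::euclidean_space \<Rightarrow> real" and f g :: "'a \<Rightarrow> real"
  assumes \<nu>: "is_norm \<nu>" and EF: "bounded E" "bounded F" "E \<noteq> {}" "F \<noteq> {}"
    and r: "hausdorff_dist \<nu> E F \<le> r" and K: "K \<ge> 0"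
    and fg: "\<And>x y. x \<in> E \<Longrightarrow> y \<in> F \<Longrightarrow> \<bar>f x - g y\<bar> \<le> a + K * \<nu> (x - y)"
  shows "\<bar>(INF x\<in>E. f x) - (INF y\<in>F. g y)\<bar> \<le> a + K * r"
proof -
  have "(INF y\<in>F. g y) \<le> (INF x\<in>E. f x) + (a + K * r)"
    by (rule INF_le_of_hausdorff_dist_le[OF \<nu> EF r K fg])
  moreover have "(INF x\<in>E. f x) \<le> (INF y\<in>F. g y) + (a + K * r)"
  proof (rule INF_le_of_hausdorff_dist_le[OF \<nu> EF(2,1,4,3) _ K])
    show "hausdorff_dist \<nu> F E \<le> r"
      using r by (simp add: hausdorff_dist_commute[OF \<nu>])
    show "\<bar>g y - f x\<bar> \<le> a + K * \<nu> (y - x)" if "y \<in> F" "x \<in> E" for x y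
      using fg[OF that(2,1)] is_norm_minus_commute[OF \<nu>, of x y] by (simp add: abs_minus_commute)
  qed
  ultimately show ?thesis by linarith
qed

lemma Max_diff_le:
  fixes f g :: "'b \<Rightarrow> real"
  assumes "finite A" "A \<noteq> {}" "\<And>k. k \<in> A \<Longrightarrow> \<bar>f k - g k\<bar> \<le> d"
  shows "\<bar>(MAX k\<in>A. f k) - (MAX k\<in>A. g k)\<bar> \<le> d"
proof -
  have "(MAX k\<in>A. h k) \<le> (MAX k\<in>A. h' k) + d"
    if "\<And>k. k \<in> A \<Longrightarrow> h k \<le> h' k + d" for h h' :: "'b \<Rightarrow> real"
  proof (rule Max.boundedI)
    fix a assume "a \<in> h ` A"
    then obtain k where k: "k \<in> A" "a = h k" by blast
    then have "h' k \<le> (MAX k\<in>A. h' k)" using assms(1) by simp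
    with that[OF k(1)] k(2) show "a \<le> (MAX k\<in>A. h' k) + d" by simp
  qed (use assms in auto)
  from this[of f g] this[of g f] assms(3) show ?thesis
    by (smt (verit))
qed

section \<open>Recursion for the Lipschitz constants\<close>

lemma lip_const_nonneg: "L\<^sub>c \<ge> 0 \<Longrightarrow> L\<^sub>\<Theta> \<ge> 0 \<Longrightarrow> 0 \<le> lip_const L\<^sub>c L\<^sub>\<Theta> T t"
  by (simp add: lip_const_def sum_nonneg)

lemma lip_const_final: "lip_const L\<^sub>c L\<^sub>\<Theta> T T = L\<^sub>c * (1 + L\<^sub>\<Theta>)"
  by (simp add: lip_const_def)

lemma lip_const_step:
  assumes "t < T"
  shows "lip_const L\<^sub>c L\<^sub>\<Theta> T t = (1 + L\<^sub>\<Theta>) * (L\<^sub>c + lip_const L\<^sub>c L\<^sub>\<Theta> T (t + 1))"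
proof -
  \<comment> \<open>Pulling out one factor \<open>q\<close> leaves the exponent-0 term plus a sum
    one term shorter, which is the sum belonging to \<open>t + 1\<close>.\<close>
  have *: "(\<Sum>k = 1..n + 1. q ^ k) = q * (1 + (\<Sum>k = 1..n. q ^ k))" for n and q :: real
    by (subst sum.atLeast_Suc_atMost)
       (simp_all add: sum.shift_bounds_cl_Suc_ivl sum_distrib_left distrib_left del: sum.cl_ivl_Suc)
  have "T - t + 1 = (T - (t + 1) + 1) + 1" using assms by simp
  then show ?thesis
    using *[of "1 + L\<^sub>\<Theta>" "T - (t + 1) + 1"] unfolding lip_const_def
    by (simp only: distrib_left mult_1_right mult.left_commute mult.commute[of _ L\<^sub>c])
qed

theorem theorem2:
  fixes \<nu> :: "real ^ 'd \<Rightarrow> real"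
    and X :: "(real ^ 'd) set"
    and T :: nat
    and \<V> :: "'v set"
    and \<E> :: "('v \<times> 'v) set"
    and Q :: "nat \<Rightarrow> 'v \<Rightarrow> (real ^ 'd) set"
    and \<R> :: "real ^ 'd \<Rightarrow> (real ^ 'd) set"
    and c :: "real ^ 'd \<Rightarrow> real ^ 'd \<Rightarrow> real"
    and L\<^sub>c L\<^sub>\<Theta> :: real
  assumes norm: "is_norm \<nu>"
    and X_compact: "compact X"
    and horizon: "T \<ge> 1"
    and graph: "finite \<V>" "\<E> \<subseteq> \<V> \<times> \<V>"
    and nbrs_nonempty: "\<forall>i\<in>\<V>. nbrs \<V> \<E> i \<noteq> {}"
    and Q_subset: "\<forall>t\<in>{0..T}. \<forall>i\<in>\<V>. Q t i \<subseteq> X"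
    and R_correspondence: "correspondence X X \<R>"
    and c_nonneg: "\<forall>x\<in>X. \<forall>y\<in>X. 0 \<le> c x y"
    and R_bodies: "\<forall>x\<in>X. solid (\<R> x) \<and> compact (\<R> x) \<and> convex (\<R> x)"
    and Q_bodies: "\<forall>t\<in>{0..T}. \<forall>i\<in>\<V>. solid (Q t i) \<and> compact (Q t i) \<and> convex (Q t i)"
    and feasible: "\<forall>t\<in>{1..T}. \<forall>i\<in>\<V>. \<forall>j\<in>nbrs \<V> \<E> i. \<forall>x\<in>Q (t - 1) i.
      interior (\<R> x \<inter> Q t j) \<noteq> {}"
    and c_continuous: "continuous_on (X \<times> X) (\<lambda>(x, y). c x y)"
    and R_continuous: "continuous_correspondence X X \<R>"
    and L\<^sub>c_nonneg: "L\<^sub>c \<ge> 0"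
    and c_lipschitz: "\<forall>x\<in>X. \<forall>y\<in>X. \<forall>x'\<in>X. \<forall>y'\<in>X.
      \<bar>c x y - c x' y'\<bar> \<le> L\<^sub>c * (\<nu> (x - x') + \<nu> (y - y'))"
    and L\<^sub>\<Theta>_nonneg: "L\<^sub>\<Theta> \<ge> 0"
    and Theta_lipschitz: "\<forall>t\<in>{1..T}. \<forall>i\<in>\<V>. \<forall>j\<in>\<V>. i \<in> nbrs \<V> \<E> j \<longrightarrow>
      (\<forall>x\<in>Q (t - 1) j. \<forall>x'\<in>Q (t - 1) j.
        hausdorff_dist \<nu> (Theta \<R> Q t i x) (Theta \<R> Q t i x') \<le> L\<^sub>\<Theta> * \<nu> (x - x'))"
  shows "\<forall>t\<in>{1..T}. \<forall>i\<in>\<V>. \<forall>j\<in>nbrs \<V> \<E> i. \<forall>x\<in>Q (t - 1) i. \<forall>x'\<in>Q (t - 1) i.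
      \<bar>V_value c (Theta \<R> Q) (nbrs \<V> \<E>) T t x j - V_value c (Theta \<R> Q) (nbrs \<V> \<E>) T t x' j\<bar>
        \<le> lip_const L\<^sub>c L\<^sub>\<Theta> T t * \<nu> (x - x') \<and>
      \<bar>U_value c (Theta \<R> Q) (nbrs \<V> \<E>) T t x i - U_value c (Theta \<R> Q) (nbrs \<V> \<E>) T t x' i\<bar>
        \<le> lip_const L\<^sub>c L\<^sub>\<Theta> T t * \<nu> (x - x')"
proof -
  have Q_X: "x \<in> X" if "t \<in> {1..T}" "i \<in> \<V>" "x \<in> Q (t - 1) i" for t i x
    proof -
    have "t - 1 \<in> {0..T}" using that(1) by auto
    with Q_subset that show ?thesis by blast
  qed
  have nbrs_V: "j \<in> \<V>" if "j \<in> nbrs \<V> \<E> i" for i j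
    using that by (simp add: nbrs_def)
  have nbrs_finite: "finite (nbrs \<V> \<E> i)" for i
    using graph(1) by (simp add: nbrs_def)
  \<comment> \<open>One stage with an abstract continuation \<open>W\<close>. It serves the final
    time with \<open>W = 0\<close>, \<open>V\<close> with the maximum over next neighbours, and
    \<open>U\<close> with its own next value.\<close>
  have stage: "\<bar>(INF y\<in>Theta \<R> Q t j x. c x y + W y) - (INF y\<in>Theta \<R> Q t j x'. c x' y + W y)\<bar>
      \<le> (L\<^sub>c * (1 + L\<^sub>\<Theta>) + L * L\<^sub>\<Theta>) * \<nu> (x - x')"
    if t: "t \<in> {1..T}" and i: "i \<in> \<V>" and j: "j \<in> nbrs \<V> \<E> i"
      and x: "x \<in> Q (t - 1) i" and x': "x' \<in> Q (t - 1) i" and L: "L \<ge> 0"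
      and W: "\<And>y y'. y \<in> Q t j \<Longrightarrow> y' \<in> Q t j \<Longrightarrow> \<bar>W y - W y'\<bar> \<le> L * \<nu> (y - y')"
    for t i j x x' L and W :: "real ^ 'd \<Rightarrow> real"
  proof -
    \<comment> \<open>A nonempty interior yields a feasible point, so the infima range over nonempty
      sets.\<close>
    have nonempty: "Theta \<R> Q t j z \<noteq> {}" if "z \<in> Q (t - 1) i" for z
      proof -
      have "interior (Theta \<R> Q t j z) \<noteq> {}"
        using feasible[rule_format, OF t i j that] by (simp add: Theta_def)
      then show ?thesis by auto
    qed
    have "t \<in> {0..T}" using t by simp
    then have "Q t j \<subseteq> X" using Q_subset nbrs_V[OF j] by blast
    then have Theta_X: "Theta \<R> Q t j z \<subseteq> X" for z by (auto simp: Theta_def)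
    have bdd: "bounded (Theta \<R> Q t j z)" for z
      using Theta_X by (rule bounded_subset[OF compact_imp_bounded[OF X_compact]])
    \<comment> \<open>The change of state costs \<open>L\<^sub>c * \<nu> (x - x')\<close>. Moving
      the target changes both cost and continuation, hence the factor \<open>L\<^sub>c + L\<close>
      on the Hausdorff bound.\<close>
    have "\<bar>(INF y\<in>Theta \<R> Q t j x. c x y + W y) - (INF y\<in>Theta \<R> Q t j x'. c x' y + W y)\<bar>
        \<le> L\<^sub>c * \<nu> (x - x') + (L\<^sub>c + L) * (L\<^sub>\<Theta> * \<nu> (x - x'))"
    proof (rule INF_diff_le_of_hausdorff_dist_le[OF norm bdd bdd nonempty[OF x] nonempty[OF x']])
      show "hausdorff_dist \<nu> (Theta \<R> Q t j x) (Theta \<R> Q t j x') \<le> L\<^sub>\<Theta> * \<nu> (x - x')"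
        by (rule Theta_lipschitz[rule_format, OF t nbrs_V[OF j] i j x x'])
      show "0 \<le> L\<^sub>c + L" using L\<^sub>c_nonneg L by simp
      fix y y' assume y: "y \<in> Theta \<R> Q t j x" "y' \<in> Theta \<R> Q t j x'"
      have "\<bar>c x y - c x' y'\<bar> \<le> L\<^sub>c * (\<nu> (x - x') + \<nu> (y - y'))"
        by (intro c_lipschitz[rule_format] Q_X[OF t i x] Q_X[OF t i x'] subsetD[OF Theta_X y(1)]
          subsetD[OF Theta_X y(2)])
      moreover have "\<bar>W y - W y'\<bar> \<le> L * \<nu> (y - y')"
        using y by (intro W) (auto simp: Theta_def)
      ultimately show "\<bar>c x y + W y - (c x' y' + W y')\<bar>
          \<le> L\<^sub>c * \<nu> (x - x') + (L\<^sub>c + L) * \<nu> (y - y')"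
        by (simp add: algebra_simps)
    qed
    then show ?thesis by (simp add: algebra_simps)
  qed
  let ?V = "V_value c (Theta \<R> Q) (nbrs \<V> \<E>) T"
  let ?U = "U_value c (Theta \<R> Q) (nbrs \<V> \<E>) T"
  let ?L = "lip_const L\<^sub>c L\<^sub>\<Theta> T"
  let ?P = "\<lambda>t. \<forall>i\<in>\<V>. \<forall>j\<in>nbrs \<V> \<E> i. \<forall>x\<in>Q (t - 1) i. \<forall>x'\<in>Q (t - 1) i.
      \<bar>?V t x j - ?V t x' j\<bar> \<le> ?L t * \<nu> (x - x') \<and> \<bar>?U t x i - ?U t x' i\<bar> \<le> ?L t * \<nu> (x - x')"
  have "?P t" if "t \<le> T" "1 \<le> t" for t
    using that
  \<comment> \<open>Downward from \<open>T\<close>. The premise \<open>1 <= t\<close> stays inside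
    the induction statement and keeps \<open>t\<close> in the range \<open>{1..T}\<close> of the
    assumptions.\<close>
  proof (induction t rule: inc_induct)
    case base
    show ?case
    proof (intro ballI conjI)
      fix i j x x'
      assume i: "i \<in> \<V>" and j: "j \<in> nbrs \<V> \<E> i" and x: "x \<in> Q (T - 1) i" "x' \<in> Q (T - 1) i"
      have *: "\<bar>(INF y\<in>Theta \<R> Q T k x. c x y) - (INF y\<in>Theta \<R> Q T k x'. c x' y)\<bar>
          \<le> ?L T * \<nu> (x - x')" if "k \<in> nbrs \<V> \<E> i" for k
        \<comment> \<open>With zero continuation and \<open>L = 0\<close>, the stage bound is
          exactly \<open>?L T\<close>.\<close>
        using stage[of T i k x x' 0 "\<lambda>_. 0"] horizon i that x by (simp add: lip_const_final)
      show "\<bar>?V T x j - ?V T x' j\<bar> \<le> ?L T * \<nu> (x - x')"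
        using *[OF j] by (simp add: V_value_final)
      show "\<bar>?U T x i - ?U T x' i\<bar> \<le> ?L T * \<nu> (x - x')"
        unfolding U_value_final using j * by (intro Max_diff_le nbrs_finite) auto
    qed
  next
    case (step t)
    then have t: "t \<in> {1..T}" by simp
    \<comment> \<open>Its domain is \<open>Q (t + 1 - 1)\<close>, that is \<open>Q t\<close>,
      exactly where the continuation at stage \<open>t\<close> is evaluated.\<close>
    have IH: "?P (t + 1)" using step by simp
    show ?case
    proof (intro ballI conjI)
      fix i j x x'
      assume i: "i \<in> \<V>" and j: "j \<in> nbrs \<V> \<E> i" and x: "x \<in> Q (t - 1) i" "x' \<in> Q (t - 1) i"
      have *: "\<bar>(INF y\<in>Theta \<R> Q t k x. c x y + W y) - (INF y\<in>Theta \<R> Q t k x'. c x' y + W y)\<bar>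
          \<le> ?L t * \<nu> (x - x')"
        if k: "k \<in> nbrs \<V> \<E> i"
          and W: "\<And>y y'. y \<in> Q t k \<Longrightarrow> y' \<in> Q t k \<Longrightarrow> \<bar>W y - W y'\<bar> \<le> ?L (t + 1) * \<nu> (y - y')"
        for k and W :: "real ^ 'd \<Rightarrow> real"
      proof -
        have L: "0 \<le> ?L (t + 1)" by (rule lip_const_nonneg[OF L\<^sub>c_nonneg L\<^sub>\<Theta>_nonneg])
        \<comment> \<open>The recursion gives
          \<open>?L t = (1 + L\<^sub>\<Theta>) * (L\<^sub>c + ?L (t + 1))\<close>, which exceeds the
          stage constant by \<open>?L (t + 1)\<close>; hence the appeal to nonnegativity.\<close>
        have "L\<^sub>c * (1 + L\<^sub>\<Theta>) + ?L (t + 1) * L\<^sub>\<Theta> \<le> ?L t"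
          using L by (simp add: lip_const_step[OF \<open>t < T\<close>] algebra_simps)
        moreover have "0 \<le> \<nu> (x - x')" using norm by (simp add: is_norm_def)
        ultimately have "(L\<^sub>c * (1 + L\<^sub>\<Theta>) + ?L (t + 1) * L\<^sub>\<Theta>) * \<nu> (x - x') \<le> ?L t * \<nu> (x - x')"
          by (rule mult_right_mono)
        then show ?thesis using stage[OF t i k x L W] by linarith
      qed
      show "\<bar>?V t x j - ?V t x' j\<bar> \<le> ?L t * \<nu> (x - x')"
        \<comment> \<open>The hypothesis is used at vertex \<open>j\<close> with each
          \<open>k\<close> in its neighbourhood; the maximum over these \<open>k\<close> keeps the
          constant \<open>?L (t + 1)\<close>.\<close>
        unfolding V_value_step[OF \<open>t < T\<close>]
        using IH nbrs_V[OF j] nbrs_nonempty by (intro * j Max_diff_le nbrs_finite) auto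
      show "\<bar>?U t x i - ?U t x' i\<bar> \<le> ?L t * \<nu> (x - x')"
        unfolding U_value_step[OF \<open>t < T\<close>]
      proof (intro Max_diff_le nbrs_finite *)
        fix k y y' assume k: "k \<in> nbrs \<V> \<E> i" and y: "y \<in> Q t k" "y' \<in> Q t k"
        \<comment> \<open>\<open>?P\<close> states the bounds for \<open>V\<close> and
          \<open>U\<close> jointly along an edge, so extracting the \<open>U\<close> half at
          \<open>k\<close> requires some neighbour \<open>l\<close>, although that half does not
          mention it.\<close>
        obtain l where "l \<in> nbrs \<V> \<E> k" using nbrs_nonempty nbrs_V[OF k] by blast
        then show "\<bar>?U (t + 1) y k - ?U (t + 1) y' k\<bar> \<le> ?L (t + 1) * \<nu> (y - y')"
          using IH nbrs_V[OF k] y by simp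
      qed (use j in auto)
    qed
  qed
  then show ?thesis by simp
qed

end
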